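(* Let $N\geq 3$ be an integer and let $c=(c_j)=(c_1,\dots,c_N)$ be a solution of $$\frac{dc_j}{dt}=\sum_{k=1}^{N-j}c_{j+k}c_k-c_j\sum_{k=1}^{N}c_k,\qquad j=1,\dots,N,$$ satisfying $c_j(0)\geq 0$ for all $j=1,\dots,N$. Let $P=\{j\in\mathbb{N}\cap[1,N] : c_j(0)>0\}$. If $m:=\gcd(P)$ and $p:=\sup P$, then, for each $j=m,2m,\dots,p$, there exists $e_j:[0,\infty)\to\mathbb{R}$ such that $e_j(t)\to 0$ as $t\to\infty$, and $$c_j(t)=\frac{\widetilde{A}_j}{t(\log t)^{j/m-1}}\,(1+e_j(t)),\qquad\text{where}\quad \widetilde{A}_j:=\frac{(N-1)!}{(N-j/m)!}.$$ For all other $j\in\mathbb{N}\cap[1,N]$, $c_j(t)=0$ for all $t\geq 0$.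
   Context: The system is the finite-dimensional Redner--Ben-Avraham--Kahng coagulation system with constant coefficients $a_{j,k}=1$. The first sum on the right-hand side is defined to be zero when $j=N$. Solutions with $c_j(0)\geq 0$ for $j=1,\dots,N$ are defined for all $t\in[0,\infty)$ and satisfy $c_j(t)\geq 0$ for all $j=1,\dots,N$ and all positive $t$. $P$ is the set of subscript values for which the components of the initial condition $c(0)$ are positive, and $\gcd(P)$ denotes the greatest common divisor of the elements of $P$.
   Formalization: The printed amplitude (N-1)!/(N-j/m)! is false in general (e.g. N=3, P={1,2}, j=2); it is replaced by (n-1)!/(n-j/m)! with n=p/m. The formula for c_j(t) is asserted wherever its denominator is nonzero. *)

theory Defs
  imports "HOL-Analysis.Analysis"
begin

(* c j t is the component c_j at time t; only the indices 1..N matter. Solutions live on the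
   half-line [0,\<infinity>), with a one-sided derivative at 0. *)

definition rbk_rhs :: "nat \<Rightarrow> (nat \<Rightarrow> real) \<Rightarrow> nat \<Rightarrow> real" where
  "rbk_rhs N x j = (\<Sum>k=1..N - j. x (j + k) * x k) - x j * (\<Sum>k=1..N. x k)"

definition rbk_solution :: "nat \<Rightarrow> (nat \<Rightarrow> real \<Rightarrow> real) \<Rightarrow> bool" where
  "rbk_solution N c \<longleftrightarrow>
     (\<forall>j\<in>{1..N}. \<forall>t\<ge>0. (c j has_real_derivative rbk_rhs N (\<lambda>k. c k t) j) (at t within {0..}))"

(* The amplitude. The source prints (N-1)!/(N-j/m)! with N the dimension of the system. For j > m
   this is the right value only if N equals n = p/m, the number of components that are not
   identically zero (that is, m = 1 and p = N); for j = m both values are 1. The amplitude is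
   therefore (n-1)!/(n-i)! with i = j/m, to be applied with n = p/m.
   With the printed value the claim fails already for N = 3 and the solution
     c_1(t) = 1/(t+1),  c_2(t) = 1/((t+1)(1+log(t+1))),  c_3(t) = 0,
   where P = {1,2}, m = 1, p = 2 and t (log t) c_2(t) tends to 1 = 1!/0!, not to 2 = 2!/1!. *)

definition amplitude :: "nat \<Rightarrow> nat \<Rightarrow> real" where
  "amplitude n i = fact (n - 1) / fact (n - i)"

end

theory Submission
  imports Defs
begin

text \<open>
  Solutions stay nonnegative, and a set of initially absent components stays absent if every
  reaction feeding one of them also consumes one of them.  Hence every component whose index is not
  a multiple of \<open>m\<close> or exceeds \<open>p\<close> is zero, and the remaining ones solve the same system in
  dimension \<open>n = p / m\<close> after the index is divided by \<open>m\<close>.  Since a reaction turns the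
  indices \<open>a > b\<close> into \<open>a - b\<close>, the components of this reduced system that are positive
  for all positive times have indices closed under differences.  These include the initial support,
  whose gcd is now 1, so by Euclid's algorithm they include 1; as they include \<open>n\<close>, stepping down
  by 1 yields all indices from 1 to \<open>n\<close>.

  For a positive solution the loss terms are all proportional, so they disappear from the
  quotients \<open>u\<^sub>j = c\<^sub>j / c\<^sub>n\<close>, which satisfy \<open>u\<^sub>j' = \<Sum>\<^sub>k c\<^sub>k u\<^sub>j\<^sub>+\<^sub>k\<close>.  Given the
  coefficients \<open>c\<^sub>k\<close>, this system is triangular: \<open>u\<^sub>n = 1\<close>, then
  \<open>u\<^sub>n\<^sub>-\<^sub>1' = c\<^sub>1\<close>, and so on downwards.  In particular
  \<open>\<tau> = u\<^sub>n\<^sub>-\<^sub>1\<close> is a clock running with speed \<open>c\<^sub>1\<close>.  If only the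
  term \<open>k = 1\<close> counted, then \<open>du\<^sub>j / d\<tau> = u\<^sub>j\<^sub>+\<^sub>1\<close>, and \<open>u\<^sub>j\<close> would grow
  like \<open>\<tau>^(n-j) / (n-j)!\<close>.  The other terms are indeed negligible: comparing derivatives,
  downwards in \<open>j\<close>, first gives \<open>u\<^sub>j\<^sub>+\<^sub>1 \<le> K u\<^sub>j\<close> and then the gain of one
  power, \<open>\<tau> u\<^sub>j\<^sub>+\<^sub>1 \<le> D u\<^sub>j\<close> (lemma \<open>\<tau>_gap\<close>).  Since \<open>\<tau> \<rightarrow> \<infinity>\<close>, this makes
  \<open>c\<^sub>k / c\<^sub>1\<close> tend to 0 for \<open>k \<ge> 2\<close>.

  The rest is l'Hospital's rule.  The derivative of \<open>1 / c\<^sub>1\<close> tends to 1, so \<open>c\<^sub>1 \<sim> 1 / t\<close>;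
  hence \<open>\<tau>' = c\<^sub>1\<close> gives \<open>\<tau> \<sim> log t\<close>, and the heuristic growth of the \<open>u\<^sub>j\<close> becomes a
  theorem by downward induction (lemma \<open>top_ratio_asymptotics\<close>).  Finally
  \<open>c\<^sub>j = c\<^sub>1 u\<^sub>j / u\<^sub>1\<close>, where \<open>u\<^sub>j / u\<^sub>1\<close> behaves like
  \<open>(n-1)! / (n-j)! \<cdot> (log t)^(1-j)\<close>.
\<close>

section \<open>Differential inequalities\<close>

text \<open>
  Gronwall's inequality in differential form: \<open>f t * exp (- C * t)\<close> is nonincreasing.
  Differentiability is asked for in the open interval only, because a
  solution has just a one-sided derivative at time 0.
\<close>

lemma linear_growth_bound:
  fixes f :: "real \<Rightarrow> real"
  assumes "a \<le> b" and con: "continuous_on {a..b} f"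
    and der: "\<And>t. a < t \<Longrightarrow> t < b \<Longrightarrow> \<exists>D. (f has_real_derivative D) (at t) \<and> D \<le> C * f t"
  shows "f b \<le> f a * exp (C * (b - a))"
proof -
  have "f b * exp (- C * b) \<le> f a * exp (- C * a)"
  proof (rule DERIV_nonpos_imp_decreasing_open[of a b "\<lambda>t. f t * exp (- C * t)"])
    fix t assume t: "a < t" "t < b"
    then obtain D where D: "(f has_real_derivative D) (at t)" "D \<le> C * f t"
      using der by blast
    have "((\<lambda>t. f t * exp (- C * t)) has_real_derivative (D - C * f t) * exp (- C * t)) (at t)"
      by (auto intro!: derivative_eq_intros D(1) simp: algebra_simps)
    moreover have "(D - C * f t) * exp (- C * t) \<le> 0"
      using D(2) by (intro mult_nonpos_nonneg) auto
    ultimately show "\<exists>y. ((\<lambda>t. f t * exp (- C * t)) has_real_derivative y) (at t) \<and> y \<le> 0"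
      by blast
  qed (use assms(1) con in \<open>auto intro!: continuous_intros\<close>)
  then have "f b * exp (- C * b) * exp (C * b) \<le> f a * exp (- C * a) * exp (C * b)"
    by (intro mult_right_mono) auto
  then show ?thesis
    by (simp add: mult.assoc algebra_simps flip: exp_add)
qed

lemma linear_decay_bound:
  fixes f :: "real \<Rightarrow> real"
  assumes "a \<le> b" and con: "continuous_on {a..b} f"
    and der: "\<And>t. a < t \<Longrightarrow> t < b \<Longrightarrow> \<exists>D. (f has_real_derivative D) (at t) \<and> C * f t \<le> D"
  shows "f a * exp (C * (b - a)) \<le> f b"
proof -
  have "- f b \<le> - f a * exp (C * (b - a))"
  proof (rule linear_growth_bound[of a b "\<lambda>t. - f t"])
    fix t assume "a < t" "t < b"
    then obtain D where "(f has_real_derivative D) (at t)" "C * f t \<le> D"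
      using der by blast
    then show "\<exists>D. ((\<lambda>t. - f t) has_real_derivative D) (at t) \<and> D \<le> C * - f t"
      by (intro exI[of _ "- D"]) (auto intro!: derivative_eq_intros)
  qed (use assms(1) con in \<open>auto intro!: continuous_intros\<close>)
  then show ?thesis by simp
qed

lemma le_by_derivative:
  fixes f g :: "real \<Rightarrow> real"
  assumes "a \<le> t" "f a \<le> g a"
    and f: "\<And>s. a \<le> s \<Longrightarrow> (f has_real_derivative f' s) (at s)"
    and g: "\<And>s. a \<le> s \<Longrightarrow> (g has_real_derivative g' s) (at s)"
    and le: "\<And>s. a \<le> s \<Longrightarrow> f' s \<le> g' s"
  shows "f t \<le> g t"
proof -
  have "(\<lambda>s. g s - f s) a \<le> (\<lambda>s. g s - f s) t"
  proof (rule DERIV_nonneg_imp_nondecreasing[OF \<open>a \<le> t\<close>])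
    fix s assume "a \<le> s"
    then show "\<exists>y. ((\<lambda>s. g s - f s) has_real_derivative y) (at s) \<and> y \<ge> 0"
      using f[of s] g[of s] le[of s]
      by (intro exI[of _ "g' s - f' s"]) (auto intro!: DERIV_diff)
  qed
  then show ?thesis using assms(2) by simp
qed

text \<open>
  The negative part itself has a corner at 0; its square is continuously differentiable, which is why
  the square measures the failure of nonnegativity below.
\<close>

lemma negative_part_square_has_derivative:
  "((\<lambda>x::real. (min x 0)\<^sup>2) has_real_derivative 2 * min x 0) (at x)"
proof -
  consider "x < 0" | "x > 0" | "x = 0" by linarith
  then show ?thesis
  proof cases
    case 1
    have "((\<lambda>x::real. x\<^sup>2) has_real_derivative 2 * min x 0) (at x)"
      using 1 by (auto intro!: derivative_eq_intros)
    then show ?thesis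
      by (rule has_field_derivative_transform_within_open[of _ _ _ "{..<0}"]) (use 1 in auto)
  next
    case 2
    have "((\<lambda>x::real. 0) has_real_derivative 2 * min x 0) (at x)"
      using 2 by (auto intro!: derivative_eq_intros)
    then show ?thesis
      by (rule has_field_derivative_transform_within_open[of _ _ _ "{0<..}"]) (use 2 in auto)
  next
    case 3
    have "((\<lambda>h::real. (min h 0)\<^sup>2 / h) \<longlongrightarrow> 0) (at 0)"
    proof (rule tendsto_0_le[where f = "\<lambda>h. h" and K = 1])
      show "\<forall>\<^sub>F h in at 0. norm ((min h 0)\<^sup>2 / h) \<le> norm (h::real) * 1"
        by (auto simp: min_def power2_eq_square)
    qed auto
    then show ?thesis
      using 3 by (simp add: has_field_derivative_iff)
  qed
qed

section \<open>Sign and support of solutions\<close>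

lemma rbk_solution_deriv:
  assumes "rbk_solution N c" "j \<in> {1..N}" "t > 0"
  shows "(c j has_real_derivative rbk_rhs N (\<lambda>k. c k t) j) (at t)"
proof -
  have "(c j has_real_derivative rbk_rhs N (\<lambda>k. c k t) j) (at t within {0..})"
    using assms by (simp add: rbk_solution_def)
  moreover have "at t within {0..} = at t"
    using assms(3) by (intro at_within_interior) (simp add: interior_real_atLeast)
  ultimately show ?thesis by simp
qed

lemma rbk_solution_continuous:
  assumes "rbk_solution N c" "j \<in> {1..N}"
  shows "continuous_on {0..} (c j)"
  unfolding continuous_on_eq_continuous_within
  using assms DERIV_continuous unfolding rbk_solution_def by (metis atLeast_iff)

lemma rbk_solution_bounded:
  assumes "rbk_solution N c" "T \<ge> 0"
  obtains M where "M \<ge> 0" "\<And>j t. j \<in> {1..N} \<Longrightarrow> t \<in> {0..T} \<Longrightarrow> \<bar>c j t\<bar> \<le> M"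
proof -
  have "\<exists>B. \<forall>t\<in>{0..T}. \<bar>c j t\<bar> \<le> B" if j: "j \<in> {1..N}" for j
  proof -
    have "continuous_on {0..T} (c j)"
      using rbk_solution_continuous[OF assms(1) j] by (rule continuous_on_subset) auto
    then have "bounded (c j ` {0..T})"
      by (intro compact_imp_bounded compact_continuous_image) auto
    then show ?thesis by (auto simp: bounded_iff)
  qed
  then obtain B where B: "\<And>j t. j \<in> {1..N} \<Longrightarrow> t \<in> {0..T} \<Longrightarrow> \<bar>c j t\<bar> \<le> B j"
    by metis
  show thesis
  proof (rule that[of "\<Sum>j=1..N. \<bar>B j\<bar>"])
    fix j t assume jt: "j \<in> {1..N}" "t \<in> {0..T}"
    have "\<bar>c j t\<bar> \<le> \<bar>B j\<bar>" using B[OF jt] by simp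
    also have "\<dots> \<le> (\<Sum>j=1..N. \<bar>B j\<bar>)"
      using jt by (intro member_le_sum) auto
    finally show "\<bar>c j t\<bar> \<le> (\<Sum>j=1..N. \<bar>B j\<bar>)" .
  qed (simp add: sum_nonneg)
qed

text \<open>
  A gain term can be negative only to the extent that one of its factors is: the bound is linear in
  the negative parts.
\<close>

lemma product_lower_bound:
  fixes a b M :: real
  assumes "\<bar>a\<bar> \<le> M" "\<bar>b\<bar> \<le> M"
  shows "a * b \<ge> M * (min a 0 + min b 0)"
proof -
  have *: "x * y \<ge> M * (min x 0 + min y 0)" if "\<bar>x\<bar> \<le> M" "\<bar>y\<bar> \<le> M" "x \<le> y" for x y :: real
  proof -
    consider "x \<ge> 0" | "x < 0" "y \<ge> 0" | "x < 0" "y < 0" by linarith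
    then show ?thesis
    proof cases
      case 1 then show ?thesis using that by simp
    next
      case 2
      then have "x * y \<ge> x * M" using that by (intro mult_left_mono_neg) auto
      then show ?thesis using 2 by (simp add: mult.commute)
    next
      case 3
      have "x * y \<ge> 0" using 3 by (simp add: mult_nonpos_nonpos)
      moreover have "M * (min x 0 + min y 0) \<le> 0"
        using 3 that by (intro mult_nonneg_nonpos) auto
      ultimately show ?thesis by linarith
    qed
  qed
  show ?thesis
    using *[of a b] *[of b a] assms by (cases "a \<le> b") (auto simp: algebra_simps)
qed

text \<open>
  Let \<open>f\<close> be the sum of the squared negative parts. Where \<open>c j t\<close> is negative, the loss term
  is proportional to it and the gain term is bounded below by the negative parts, so \<open>f' \<le> const * f\<close>
  on every bounded interval. Since \<open>f\<close> starts at 0, Gronwall's inequality keeps it there.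
\<close>

lemma rbk_solution_nonneg:
  assumes sol: "rbk_solution N c" and init: "\<And>j. j \<in> {1..N} \<Longrightarrow> c j 0 \<ge> 0"
    and j: "j \<in> {1..N}" and "T \<ge> 0"
  shows "c j T \<ge> 0"
proof -
  obtain M where M: "M \<ge> 0" "\<And>j t. j \<in> {1..N} \<Longrightarrow> t \<in> {0..T} \<Longrightarrow> \<bar>c j t\<bar> \<le> M"
    using rbk_solution_bounded[OF sol \<open>T \<ge> 0\<close>] by metis
  define f where "f t = (\<Sum>j=1..N. (min (c j t) 0)\<^sup>2)" for t
  \<comment> \<open>\<open>4 * N * M\<close> bounds the gains, with \<open>N\<close> from Cauchy--Schwarz; \<open>2 * N * M\<close> bounds the losses\<close>
  have "f T \<le> f 0 * exp (6 * N * M * (T - 0))"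
  proof (rule linear_growth_bound[OF \<open>T \<ge> 0\<close>])
    show "continuous_on {0..T} f"
      unfolding f_def
      by (intro continuous_intros continuous_on_subset[OF rbk_solution_continuous[OF sol]]) auto
    fix t assume t: "0 < t" "t < T"
    have b: "\<bar>c i t\<bar> \<le> M" if "i \<in> {1..N}" for i using M(2)[OF that] t by auto
    define u where "u i = - min (c i t) 0" for i
    have u0: "u i \<ge> 0" for i by (simp add: u_def)
    define S where "S = (\<Sum>i=1..N. u i)"
    have uS: "u i \<le> S" if "i \<in> {1..N}" for i
      unfolding S_def using that u0 by (intro member_le_sum) auto
    let ?D = "\<Sum>j=1..N. 2 * min (c j t) 0 * rbk_rhs N (\<lambda>k. c k t) j"
    have "(f has_real_derivative ?D) (at t)"
      unfolding f_def
      by (intro DERIV_sum DERIV_chain2[OF negative_part_square_has_derivative]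
            rbk_solution_deriv[OF sol]) (use t in auto)
    moreover have "?D \<le> 6 * N * M * f t"
    proof -
      have term_bound: "2 * min (c i t) 0 * rbk_rhs N (\<lambda>k. c k t) i \<le> 4 * M * (u i * S) + 2 * N * M * (u i)\<^sup>2"
        if i: "i \<in> {1..N}" for i
      proof -
        have "(\<Sum>k=1..N - i. c (i + k) t * c k t) \<ge> (\<Sum>k=1..N - i. - M * (u (i + k) + u k))"
        proof (rule sum_mono)
          fix k assume "k \<in> {1..N - i}"
          then have "i + k \<in> {1..N}" "k \<in> {1..N}" using i by auto
          from product_lower_bound[OF b[OF this(1)] b[OF this(2)]]
          show "- M * (u (i + k) + u k) \<le> c (i + k) t * c k t"
            by (simp add: u_def algebra_simps)
        qed
        moreover have "(\<Sum>k=1..N - i. - M * (u (i + k) + u k))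
            = - M * ((\<Sum>k=1..N - i. u (i + k)) + (\<Sum>k=1..N - i. u k))"
          by (simp only: sum.distrib[symmetric] sum_distrib_left)
        moreover have "(\<Sum>k=1..N - i. u (i + k)) \<le> S"
        proof -
          have "(\<Sum>k=1..N - i. u (i + k)) = sum u ((+) i ` {1..N - i})"
            by (subst sum.reindex) auto
          also have "\<dots> \<le> S" unfolding S_def
            using i u0 by (intro sum_mono2) auto
          finally show ?thesis .
        qed
        moreover have "(\<Sum>k=1..N - i. u k) \<le> S"
          unfolding S_def using u0 by (intro sum_mono2) auto
        ultimately have "(\<Sum>k=1..N - i. c (i + k) t * c k t) \<ge> - M * (S + S)"
          using M(1) by (smt (verit) mult_left_mono mult_minus_left)
        then have "u i * (\<Sum>k=1..N - i. c (i + k) t * c k t) \<ge> u i * (- M * (S + S))"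
          using u0 by (intro mult_left_mono) auto
        moreover have "c i t * u i = - (u i)\<^sup>2"
          by (auto simp: u_def min_def power2_eq_square)
        moreover have "(u i)\<^sup>2 * - (\<Sum>k=1..N. c k t) \<le> (u i)\<^sup>2 * (N * M)"
        proof (rule mult_left_mono)
          have "- (\<Sum>k=1..N. c k t) \<le> \<bar>\<Sum>k=1..N. c k t\<bar>" by simp
          also have "\<dots> \<le> (\<Sum>k=1..N. \<bar>c k t\<bar>)" by (rule sum_abs)
          also have "\<dots> \<le> (\<Sum>k=1..N. M)" by (intro sum_mono b)
          finally show "- (\<Sum>k=1..N. c k t) \<le> N * M" by simp
        qed simp
        moreover have "2 * min (c i t) 0 * rbk_rhs N (\<lambda>k. c k t) i
          = - 2 * (u i * (\<Sum>k=1..N - i. c (i + k) t * c k t)) + 2 * (c i t * u i) * (\<Sum>k=1..N. c k t)"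
          unfolding rbk_rhs_def u_def by (simp add: algebra_simps)
        ultimately show ?thesis by (simp add: algebra_simps)
      qed
      have "?D \<le> (\<Sum>i=1..N. 4 * M * (u i * S) + 2 * N * M * (u i)\<^sup>2)"
        by (intro sum_mono term_bound)
      also have "\<dots> = 4 * M * S\<^sup>2 + 2 * N * M * f t"
      proof -
        have "(\<Sum>i=1..N. 4 * M * (u i * S)) = 4 * M * S\<^sup>2"
          by (simp add: power2_eq_square S_def flip: sum_distrib_left sum_distrib_right)
        moreover have "(\<Sum>i=1..N. 2 * N * M * (u i)\<^sup>2) = 2 * N * M * f t"
          by (simp add: f_def u_def flip: sum_distrib_left)
        ultimately show ?thesis by (simp add: sum.distrib)
      qed
      also have "\<dots> \<le> 4 * M * (f t * N) + 2 * N * M * f t"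
      proof -
        have "S\<^sup>2 \<le> f t * N"
          using sum_squared_le_sum_of_squares[of u "{1..N}"] by (simp add: S_def f_def u_def)
        then show ?thesis using M(1) by (intro add_right_mono mult_left_mono) auto
      qed
      finally show ?thesis by (simp add: algebra_simps)
    qed
    ultimately show "\<exists>D. (f has_real_derivative D) (at t) \<and> D \<le> 6 * N * M * f t" by blast
  qed
  moreover have "f 0 = 0" unfolding f_def using init by (intro sum.neutral) auto
  ultimately have "f T \<le> 0" by simp
  moreover have "(min (c j T) 0)\<^sup>2 \<le> f T"
    unfolding f_def using j by (intro member_le_sum) auto
  ultimately have "(min (c j T) 0)\<^sup>2 \<le> 0" by linarith
  then have "min (c j T) 0 = 0" by simp
  then show ?thesis by linarith
qed

text \<open>
  Every reaction producing an index of \<open>B\<close> consumes one, so the total concentration on \<open>B\<close>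
  has a growth rate at most proportional to itself, and Gronwall's inequality keeps it at 0.
\<close>

lemma rbk_solution_zero:
  assumes sol: "rbk_solution N c" and init: "\<And>j. j \<in> {1..N} \<Longrightarrow> c j 0 \<ge> 0"
    and B: "B \<subseteq> {1..N}" "\<And>j. j \<in> B \<Longrightarrow> c j 0 = 0"
    and clos: "\<And>j k. j \<in> B \<Longrightarrow> k \<in> {1..N - j} \<Longrightarrow> j + k \<in> B \<or> k \<in> B"
    and j: "j \<in> B" and "T \<ge> 0"
  shows "c j T = 0"
proof -
  obtain M where M: "M \<ge> 0" "\<And>j t. j \<in> {1..N} \<Longrightarrow> t \<in> {0..T} \<Longrightarrow> \<bar>c j t\<bar> \<le> M"
    using rbk_solution_bounded[OF sol \<open>T \<ge> 0\<close>] by metis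
  have finB: "finite B" using B(1) finite_subset by blast
  define g where "g t = (\<Sum>j\<in>B. c j t)" for t
  have nn: "c i t \<ge> 0" if "i \<in> {1..N}" "t \<ge> 0" for i t
    using rbk_solution_nonneg[OF sol init that] by blast
  have le_g: "c i t \<le> g t" if "i \<in> B" "t \<ge> 0" for i t
    unfolding g_def using that nn B(1) finB by (intro member_le_sum) auto
  have "g T \<le> g 0 * exp (card B * N * M * (T - 0))"
  proof (rule linear_growth_bound[OF \<open>T \<ge> 0\<close>])
    show "continuous_on {0..T} g"
      unfolding g_def using B(1)
      by (intro continuous_intros continuous_on_subset[OF rbk_solution_continuous[OF sol]]) auto
    fix t assume t: "0 < t" "t < T"
    have g0: "g t \<ge> 0" unfolding g_def using nn B(1) t by (intro sum_nonneg) auto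
    let ?D = "\<Sum>j\<in>B. rbk_rhs N (\<lambda>k. c k t) j"
    have "(g has_real_derivative ?D) (at t)"
      unfolding g_def using B(1) t by (intro DERIV_sum rbk_solution_deriv[OF sol]) auto
    moreover have "?D \<le> (\<Sum>j\<in>B. N * (M * g t))"
    proof (rule sum_mono)
      fix i assume i: "i \<in> B"
      have "rbk_rhs N (\<lambda>k. c k t) i \<le> (\<Sum>k=1..N - i. c (i + k) t * c k t)"
        unfolding rbk_rhs_def using nn t i B(1)
        by (auto intro!: mult_nonneg_nonneg sum_nonneg)
      also have "\<dots> \<le> (\<Sum>k=1..N - i. M * g t)"
      proof (rule sum_mono)
        fix k assume k: "k \<in> {1..N - i}"
        then have ik: "i + k \<in> {1..N}" "k \<in> {1..N}" using i by auto
        have le: "c (i + k) t \<le> M" "c k t \<le> M" "0 \<le> c (i + k) t" "0 \<le> c k t"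
          using M(2)[OF ik(1), of t] M(2)[OF ik(2), of t] nn[OF ik(1), of t] nn[OF ik(2), of t] t by auto
        from clos[OF i k] show "c (i + k) t * c k t \<le> M * g t"
        proof
          assume "i + k \<in> B"
          then have "c (i + k) t * c k t \<le> g t * M"
            using le le_g[of "i + k" t] t g0 by (intro mult_mono) auto
          then show ?thesis by (simp add: mult.commute)
        next
          assume "k \<in> B"
          then show ?thesis using le le_g[of k t] t M(1) by (intro mult_mono) auto
        qed
      qed
      also have "\<dots> \<le> N * (M * g t)"
        using M(1) g0 by (simp add: mult_right_mono)
      finally show "rbk_rhs N (\<lambda>k. c k t) i \<le> N * (M * g t)" .
    qed
    ultimately show "\<exists>D. (g has_real_derivative D) (at t) \<and> D \<le> card B * N * M * g t"
      by (auto simp: mult.assoc)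
  qed
  moreover have "g 0 = 0" unfolding g_def using B(2) by simp
  moreover have "c j T \<ge> 0" using nn j B(1) \<open>T \<ge> 0\<close> by auto
  ultimately show ?thesis using le_g[OF j \<open>T \<ge> 0\<close>] by simp
qed

text \<open>
  Losses are proportional to the component, so it decays at most exponentially on a bounded
  interval.
\<close>

lemma rbk_solution_persistent_pos:
  assumes sol: "rbk_solution N c" and nn: "\<And>j t. j \<in> {1..N} \<Longrightarrow> t \<ge> 0 \<Longrightarrow> c j t \<ge> 0"
    and j: "j \<in> {1..N}" and "c j s > 0" "0 \<le> s" "s \<le> T"
  shows "c j T > 0"
proof -
  have "T \<ge> 0" using assms by simp
  obtain M where M: "M \<ge> 0" "\<And>j t. j \<in> {1..N} \<Longrightarrow> t \<in> {0..T} \<Longrightarrow> \<bar>c j t\<bar> \<le> M"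
    using rbk_solution_bounded[OF sol \<open>T \<ge> 0\<close>] by metis
  have "c j s * exp (- (N * M) * (T - s)) \<le> c j T"
  proof (rule linear_decay_bound[OF \<open>s \<le> T\<close>])
    show "continuous_on {s..T} (c j)"
      using \<open>0 \<le> s\<close> by (intro continuous_on_subset[OF rbk_solution_continuous[OF sol j]]) auto
    fix t assume t: "s < t" "t < T"
    have "(\<Sum>k=1..N. c k t) \<le> (\<Sum>k=1..N. M)"
      using M(2) t \<open>0 \<le> s\<close> by (intro sum_mono) (auto simp: abs_le_iff)
    then have "c j t * (\<Sum>k=1..N. c k t) \<le> c j t * (N * M)"
      using nn[OF j] t \<open>0 \<le> s\<close> by (intro mult_left_mono) auto
    moreover have "(\<Sum>k=1..N - j. c (j + k) t * c k t) \<ge> 0"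
      using nn t \<open>0 \<le> s\<close> j by (intro sum_nonneg mult_nonneg_nonneg) auto
    ultimately have "- (N * M) * c j t \<le> rbk_rhs N (\<lambda>k. c k t) j"
      by (simp add: rbk_rhs_def algebra_simps)
    then show "\<exists>D. (c j has_real_derivative D) (at t) \<and> - (N * M) * c j t \<le> D"
      using rbk_solution_deriv[OF sol j] t \<open>0 \<le> s\<close> by (intro exI conjI) auto
  qed
  moreover have "c j s * exp (- (N * M) * (T - s)) > 0" using \<open>c j s > 0\<close> by simp
  ultimately show ?thesis by linarith
qed

text \<open>
  If the component \<open>a - b\<close> vanished at \<open>t\<close>, it would have a minimum there, so its
  derivative would be 0; but that derivative contains the positive gain from \<open>a\<close> and \<open>b\<close>.
\<close>

lemma rbk_solution_pos_difference:
  assumes sol: "rbk_solution N c" and nn: "\<And>j t. j \<in> {1..N} \<Longrightarrow> t \<ge> 0 \<Longrightarrow> c j t \<ge> 0"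
    and ab: "a \<in> {1..N}" "b \<in> {1..N}" "b < a"
    and pos: "\<And>t. t > 0 \<Longrightarrow> c a t > 0" "\<And>t. t > 0 \<Longrightarrow> c b t > 0"
    and "t > 0"
  shows "c (a - b) t > 0"
proof (rule ccontr)
  assume neg: "\<not> c (a - b) t > 0"
  have ab': "a - b \<in> {1..N}" using ab by auto
  then have zero: "c (a - b) t = 0" using nn[OF ab', of t] neg \<open>t > 0\<close> by simp
  have "rbk_rhs N (\<lambda>k. c k t) (a - b) = 0"
  proof (rule DERIV_local_min[OF rbk_solution_deriv[OF sol ab' \<open>t > 0\<close>] \<open>t > 0\<close>])
    show "\<forall>y. \<bar>t - y\<bar> < t \<longrightarrow> c (a - b) t \<le> c (a - b) y"
      using zero nn[OF ab'] by (auto simp: abs_if split: if_splits)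
  qed
  then have "(\<Sum>k=1..N - (a - b). c (a - b + k) t * c k t) = 0"
    by (simp add: rbk_rhs_def zero)
  moreover have "c (a - b + k) t * c k t \<ge> 0" if "k \<in> {1..N - (a - b)}" for k
    using that ab \<open>t > 0\<close> by (intro mult_nonneg_nonneg nn) auto
  moreover have "b \<in> {1..N - (a - b)}" using ab by auto
  ultimately have "c (a - b + b) t * c b t = 0"
    by (subst (asm) sum_nonneg_eq_0_iff) blast+
  then show False using pos[OF \<open>t > 0\<close>] ab by simp
qed

text \<open>
  Euclid's algorithm: the least element divides all others, as repeatedly subtracting it from a
  member never leaves the set.
\<close>

lemma Gcd_mem_of_closed_under_difference:
  fixes S :: "nat set"
  assumes "S \<noteq> {}" "0 \<notin> S" "\<And>a b. a \<in> S \<Longrightarrow> b \<in> S \<Longrightarrow> b < a \<Longrightarrow> a - b \<in> S"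
  shows "Gcd S \<in> S"
proof -
  define d where "d = (LEAST x. x \<in> S)"
  have "\<exists>x. x \<in> S" using assms(1) by blast
  then have d: "d \<in> S" unfolding d_def by (rule LeastI_ex)
  have least: "d \<le> x" if "x \<in> S" for x unfolding d_def using that by (rule Least_le)
  have d0: "d > 0" using d assms(2) by (metis gr0I)
  have dvd: "d dvd y" if "y \<in> S" for y
    using that
  proof (induction y rule: less_induct)
    case (less y)
    show ?case
    proof (cases "y = d")
      case False
      then have y: "d < y" using least[OF less.prems] by simp
      have "d dvd y - d" using less.IH[OF _ assms(3)[OF less.prems d y]] y d0 by simp
      then have "d dvd (y - d) + d" by (rule dvd_add) (rule dvd_refl)
      then show ?thesis using y by simp
    qed simp
  qed
  have "Gcd S = d"
    by (rule dvd_antisym[OF Gcd_dvd[OF d] Gcd_greatest[OF dvd]])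
  then show ?thesis using d by simp
qed

text \<open>
  The indices positive at all positive times contain \<open>n\<close> and are closed under differences.
  They contain the initial support, so their gcd is 1; hence 1 is among them, and stepping down
  from \<open>n\<close> by 1 reaches every index.
\<close>

lemma rbk_solution_all_pos:
  assumes sol: "rbk_solution n c" and init: "\<And>j. j \<in> {1..n} \<Longrightarrow> c j 0 \<ge> 0"
    and top: "n \<ge> 1" "c n 0 > 0" and coprime: "Gcd {j \<in> {1..n}. c j 0 > 0} = 1"
    and j: "j \<in> {1..n}" and "t > 0"
  shows "c j t > 0"
proof -
  have nn: "c i s \<ge> 0" if "i \<in> {1..n}" "s \<ge> 0" for i s
    using rbk_solution_nonneg[OF sol init that] by blast
  define S where "S = {j \<in> {1..n}. \<forall>t>0. c j t > 0}"
  have diff: "a - b \<in> S" if "a \<in> S" "b \<in> S" "b < a" for a b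
    using that rbk_solution_pos_difference[OF sol nn, of a b] unfolding S_def by auto
  have init_sub: "{j \<in> {1..n}. c j 0 > 0} \<subseteq> S"
    unfolding S_def using rbk_solution_persistent_pos[OF sol nn, where s = 0] by auto
  have nS: "n \<in> S" using init_sub top by auto
  have "Gcd S \<in> S"
    by (rule Gcd_mem_of_closed_under_difference) (use nS diff in \<open>auto simp: S_def\<close>)
  moreover have "Gcd S dvd Gcd {j \<in> {1..n}. c j 0 > 0}"
    using init_sub by (intro Gcd_greatest Gcd_dvd) auto
  ultimately have one: "1 \<in> S" using coprime by simp
  have "i < n \<Longrightarrow> n - i \<in> S" for i
  proof (induction i)
    case (Suc i)
    then have "n - i - 1 \<in> S" using diff[OF Suc.IH one] by auto
    then show ?case by simp
  qed (use nS in simp)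
  from this[of "n - j"] have "j \<in> S" using j by auto
  then show ?thesis using \<open>t > 0\<close> by (simp add: S_def)
qed

section \<open>Asymptotics of positive solutions\<close>

text \<open>
  Time 1 stands for an arbitrary positive time: at time 0 some components may still be 0, which
  rules out dividing by them.
\<close>

locale positive_rbk =
  fixes n :: nat and c :: "nat \<Rightarrow> real \<Rightarrow> real"
  assumes n1: "n \<ge> 1"
    and deriv: "\<And>j t. j \<in> {1..n} \<Longrightarrow> t \<ge> 1 \<Longrightarrow>
      (c j has_real_derivative rbk_rhs n (\<lambda>k. c k t) j) (at t)"
    and pos: "\<And>j t. j \<in> {1..n} \<Longrightarrow> t \<ge> 1 \<Longrightarrow> c j t > 0"
begin

text \<open>
  Dividing by the top component, which is only ever lost, removes the loss terms: the derivative
  of such a quotient is a combination of the quotients of higher index, with the nonnegative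
  coefficients \<open>c k t\<close>. Estimates can therefore be proved by downward induction on the index.
\<close>

definition top_ratio :: "nat \<Rightarrow> real \<Rightarrow> real" where "top_ratio j t = c j t / c n t"

lemma top_ratio_pos: "j \<in> {1..n} \<Longrightarrow> t \<ge> 1 \<Longrightarrow> top_ratio j t > 0"
  unfolding top_ratio_def using pos n1 by simp

lemma top_ratio_top: "t \<ge> 1 \<Longrightarrow> top_ratio n t = 1"
  unfolding top_ratio_def using pos[of n t] n1 by simp

lemma top_ratio_quotient: "t \<ge> 1 \<Longrightarrow> top_ratio j t / top_ratio k t = c j t / c k t"
  unfolding top_ratio_def using pos[of n t] n1 by simp

lemma top_ratio_deriv:
  assumes j: "j \<in> {1..n}" and t: "t \<ge> 1"
  shows "(top_ratio j has_real_derivative (\<Sum>k=1..n - j. c k t * top_ratio (j + k) t)) (at t)"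
proof -
  have n: "n \<in> {1..n}" using n1 by simp
  have cn: "c n t \<noteq> 0" using pos[OF n t] by simp
  have "(top_ratio j has_real_derivative
      (rbk_rhs n (\<lambda>k. c k t) j * c n t - c j t * rbk_rhs n (\<lambda>k. c k t) n) / (c n t * c n t)) (at t)"
    unfolding top_ratio_def[abs_def] by (rule DERIV_divide[OF deriv[OF j t] deriv[OF n t] cn])
  also have "(rbk_rhs n (\<lambda>k. c k t) j * c n t - c j t * rbk_rhs n (\<lambda>k. c k t) n) / (c n t * c n t)
      = (\<Sum>k=1..n - j. c (j + k) t * c k t) / c n t"
    using cn by (simp add: rbk_rhs_def field_simps)
  also have "\<dots> = (\<Sum>k=1..n - j. c k t * top_ratio (j + k) t)"
    unfolding top_ratio_def by (simp add: sum_divide_distrib mult.commute)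
  finally show ?thesis .
qed

text \<open>
  Let \<open>K\<close> be so large that \<open>top_ratio (Suc j) \<le> K * top_ratio j\<close> holds for all
  \<open>j\<close> at time 1. The inequality for larger indices implies, term by term, the same inequality
  between the derivatives at \<open>j\<close>, so it persists.
\<close>

lemma successive_ratio_bounded:
  "\<exists>K\<ge>1. \<forall>j\<in>{1..<n}. \<forall>t\<ge>1. top_ratio (Suc j) t \<le> K * top_ratio j t"
proof -
  define K where "K = 1 + (\<Sum>j=1..n. \<bar>top_ratio (Suc j) 1 / top_ratio j 1\<bar>)"
  have K1: "K \<ge> 1" unfolding K_def by (simp add: sum_nonneg)
  have init: "top_ratio (Suc j) 1 \<le> K * top_ratio j 1" if "j \<in> {1..<n}" for j
  proof -
    have "top_ratio (Suc j) 1 / top_ratio j 1 \<le> \<bar>top_ratio (Suc j) 1 / top_ratio j 1\<bar>" by (rule abs_ge_self)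
    also have "\<dots> \<le> (\<Sum>j=1..n. \<bar>top_ratio (Suc j) 1 / top_ratio j 1\<bar>)"
      using that by (intro member_le_sum) auto
    also have "\<dots> \<le> K" by (simp add: K_def)
    finally show ?thesis using top_ratio_pos[of j 1] that by (simp add: field_simps)
  qed
  have "\<forall>t\<ge>1. top_ratio (Suc j) t \<le> K * top_ratio j t" if "j \<in> {1..<n}" for j
    using that
  proof (induction "n - j" arbitrary: j rule: less_induct)
    case less
    have j: "j \<in> {1..n}" "Suc j \<in> {1..n}" using less.prems by auto
    have "top_ratio (Suc j) t \<le> K * top_ratio j t" if "t \<ge> 1" for t
    proof (rule le_by_derivative[where a = 1 and f = "top_ratio (Suc j)" and g = "\<lambda>t. K * top_ratio j t"])
      show "t \<ge> 1" "top_ratio (Suc j) 1 \<le> K * top_ratio j 1" using that init[OF less.prems] .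
      fix s :: real assume s: "1 \<le> s"
      show "(top_ratio (Suc j) has_real_derivative (\<Sum>k=1..n - Suc j. c k s * top_ratio (Suc j + k) s)) (at s)"
        by (rule top_ratio_deriv[OF j(2) s])
      show "((\<lambda>t. K * top_ratio j t) has_real_derivative K * (\<Sum>k=1..n - j. c k s * top_ratio (j + k) s)) (at s)"
        by (rule DERIV_cmult[OF top_ratio_deriv[OF j(1) s]])
      have "(\<Sum>k=1..n - Suc j. c k s * top_ratio (Suc j + k) s) \<le> (\<Sum>k=1..n - Suc j. K * (c k s * top_ratio (j + k) s))"
      proof (rule sum_mono)
        fix k assume k: "k \<in> {1..n - Suc j}"
        have "n - (j + k) < n - j" "j + k \<in> {1..<n}" using k less.prems by auto
        from less.hyps[OF this] have "top_ratio (Suc (j + k)) s \<le> K * top_ratio (j + k) s" using s by blast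
        then have "c k s * top_ratio (Suc (j + k)) s \<le> c k s * (K * top_ratio (j + k) s)"
          using k s by (intro mult_left_mono less_imp_le[OF pos]) auto
        then show "c k s * top_ratio (Suc j + k) s \<le> K * (c k s * top_ratio (j + k) s)"
          by (simp add: mult.left_commute)
      qed
      also have "\<dots> \<le> (\<Sum>k=1..n - j. K * (c k s * top_ratio (j + k) s))"
      proof (rule sum_mono2)
        fix k assume "k \<in> {1..n - j} - {1..n - Suc j}"
        then have "k \<in> {1..n}" "j + k \<in> {1..n}" using j by auto
        then show "0 \<le> K * (c k s * top_ratio (j + k) s)"
          using K1 pos[of k s] top_ratio_pos[of "j + k" s] s by simp
      qed auto
      finally show "(\<Sum>k=1..n - Suc j. c k s * top_ratio (Suc j + k) s) \<le> K * (\<Sum>k=1..n - j. c k s * top_ratio (j + k) s)"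
        by (simp add: sum_distrib_left)
    qed
    then show ?case by blast
  qed
  then show ?thesis using K1 by blast
qed

text \<open>
  The previous bound is iterated at most \<open>n\<close> times; multiplication by \<open>c n t\<close> carries it
  over from the quotients to the components.
\<close>

lemma ratio_bounded:
  obtains K where "K \<ge> 1"
    "\<And>j k t. 1 \<le> j \<Longrightarrow> j + k \<le> n \<Longrightarrow> t \<ge> 1 \<Longrightarrow> c (j + k) t \<le> K * c j t"
    "\<And>j k t. 1 \<le> j \<Longrightarrow> j + k \<le> n \<Longrightarrow> t \<ge> 1 \<Longrightarrow> top_ratio (j + k) t \<le> K * top_ratio j t"
proof -
  obtain K where K: "K \<ge> 1" "\<And>j t. j \<in> {1..<n} \<Longrightarrow> t \<ge> 1 \<Longrightarrow> top_ratio (Suc j) t \<le> K * top_ratio j t"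
    using successive_ratio_bounded by blast
  have pw: "top_ratio (j + k) t \<le> K ^ k * top_ratio j t" if "1 \<le> j" "j + k \<le> n" "t \<ge> 1" for j k t
    using that(2)
  proof (induction k)
    case (Suc k)
    have "top_ratio (Suc (j + k)) t \<le> K * top_ratio (j + k) t" using Suc.prems that by (intro K(2)) auto
    also have "\<dots> \<le> K * (K ^ k * top_ratio j t)" using Suc K(1) by (intro mult_left_mono) auto
    finally show ?case by (simp add: mult.assoc)
  qed simp
  have bound: "top_ratio (j + k) t \<le> K ^ n * top_ratio j t" if "1 \<le> j" "j + k \<le> n" "t \<ge> 1" for j k t
  proof -
    have "K ^ k * top_ratio j t \<le> K ^ n * top_ratio j t"
      using that K(1) top_ratio_pos[of j t] by (intro mult_right_mono power_increasing) auto
    then show ?thesis using pw[OF that] by linarith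
  qed
  have "c (j + k) t \<le> K ^ n * c j t" if "1 \<le> j" "j + k \<le> n" "t \<ge> 1" for j k t
    using bound[OF that] pos[of n t] that n1 by (simp add: top_ratio_def field_simps)
  then show thesis using that[of "K ^ n"] bound K(1) by (simp add: one_le_power)
qed

text \<open>
  Together with the next lemma: up to constants, the derivative is its term for \<open>k = 1\<close>.
\<close>

lemma top_ratio_deriv_lower:
  assumes "j \<in> {1..<n}" "t \<ge> 1"
  shows "c 1 t * top_ratio (Suc j) t \<le> (\<Sum>k=1..n - j. c k t * top_ratio (j + k) t)"
proof -
  have "c 1 t * top_ratio (j + 1) t \<le> (\<Sum>k=1..n - j. c k t * top_ratio (j + k) t)"
  proof (rule member_le_sum)
    fix k assume "k \<in> {1..n - j} - {1}"
    then show "0 \<le> c k t * top_ratio (j + k) t"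
      using assms by (intro mult_nonneg_nonneg less_imp_le[OF pos] less_imp_le[OF top_ratio_pos]) auto
  qed (use assms in auto)
  then show ?thesis by simp
qed

lemma top_ratio_deriv_upper:
  obtains C where "C > 0" "\<And>j t. j \<in> {1..<n} \<Longrightarrow> t \<ge> 1 \<Longrightarrow>
    (\<Sum>k=1..n - j. c k t * top_ratio (j + k) t) \<le> C * (c 1 t * top_ratio (Suc j) t)"
proof -
  obtain K where K: "K \<ge> 1"
    "\<And>j k t. 1 \<le> j \<Longrightarrow> j + k \<le> n \<Longrightarrow> t \<ge> 1 \<Longrightarrow> c (j + k) t \<le> K * c j t"
    "\<And>j k t. 1 \<le> j \<Longrightarrow> j + k \<le> n \<Longrightarrow> t \<ge> 1 \<Longrightarrow> top_ratio (j + k) t \<le> K * top_ratio j t"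
    using ratio_bounded by blast
  show thesis
  proof (rule that[of "n * (K * K)"])
    show "real n * (K * K) > 0" using n1 K(1) by simp
    fix j t assume j: "j \<in> {1..<n}" and t: "(t::real) \<ge> 1"
    have p: "c 1 t > 0" "top_ratio (Suc j) t > 0" using pos top_ratio_pos j t by auto
    have "(\<Sum>k=1..n - j. c k t * top_ratio (j + k) t) \<le> (\<Sum>k=1..n - j. (K * c 1 t) * (K * top_ratio (Suc j) t))"
    proof (rule sum_mono)
      fix k assume k: "k \<in> {1..n - j}"
      have "c k t \<le> K * c 1 t" using K(2)[of 1 "k - 1" t] k t by auto
      moreover have "top_ratio (j + k) t \<le> K * top_ratio (Suc j) t" using K(3)[of "Suc j" "k - 1" t] k t j by auto
      ultimately show "c k t * top_ratio (j + k) t \<le> (K * c 1 t) * (K * top_ratio (Suc j) t)"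
        using K(1) p top_ratio_pos[of "j + k" t] k t j by (intro mult_mono less_imp_le[OF top_ratio_pos]) auto
    qed
    also have "\<dots> = (n - j) * ((K * c 1 t) * (K * top_ratio (Suc j) t))" by simp
    also have "\<dots> \<le> n * ((K * c 1 t) * (K * top_ratio (Suc j) t))"
      using K(1) p by (intro mult_right_mono) auto
    finally show "(\<Sum>k=1..n - j. c k t * top_ratio (j + k) t) \<le> n * (K * K) * (c 1 t * top_ratio (Suc j) t)"
      by (simp add: algebra_simps)
  qed
qed

text \<open>
  An antiderivative of \<open>c 1\<close> (when \<open>n \<ge> 2\<close>) that is itself one of the quotients: the
  time scale in which the quotients grow like powers.
\<close>

definition \<tau> :: "real \<Rightarrow> real" where "\<tau> = top_ratio (n - 1)"

lemma \<tau>_pos: "n \<ge> 2 \<Longrightarrow> t \<ge> 1 \<Longrightarrow> \<tau> t > 0"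
  unfolding \<tau>_def by (intro top_ratio_pos) auto

lemma \<tau>_deriv:
  assumes "n \<ge> 2" "t \<ge> 1"
  shows "(\<tau> has_real_derivative c 1 t) (at t)"
proof -
  have "n - (n - 1) = 1" "n - 1 + 1 = n" using assms by auto
  then show ?thesis
    unfolding \<tau>_def using top_ratio_deriv[of "n - 1" t] assms top_ratio_top by simp
qed

text \<open>
  Each step down in the index gains a factor \<open>\<tau>\<close>. For \<open>j = n - 1\<close> this is the
  definition of \<open>\<tau>\<close>. Below, the derivative of \<open>\<tau> * top_ratio (Suc j)\<close> is
  at most a constant times \<open>c 1 * top_ratio (Suc j)\<close>: one summand comes from \<open>\<tau>' = c 1\<close>,
  the other from the upper derivative bound and the inequality for \<open>Suc j\<close>. The
  derivative of \<open>top_ratio j\<close> is at least \<open>c 1 * top_ratio (Suc j)\<close>.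
\<close>

lemma \<tau>_gap:
  obtains D where "D > 0" "\<And>j t. j \<in> {1..<n} \<Longrightarrow> t \<ge> 1 \<Longrightarrow> \<tau> t * top_ratio (Suc j) t \<le> D * top_ratio j t"
proof -
  obtain C where C: "C > 0" "\<And>j t. j \<in> {1..<n} \<Longrightarrow> t \<ge> 1 \<Longrightarrow>
    (\<Sum>k=1..n - j. c k t * top_ratio (j + k) t) \<le> C * (c 1 t * top_ratio (Suc j) t)"
    using top_ratio_deriv_upper by blast
  have "\<exists>D>0. \<forall>t\<ge>1. \<tau> t * top_ratio (Suc j) t \<le> D * top_ratio j t" if "j \<in> {1..<n}" for j
    using that
  proof (induction "n - j" arbitrary: j rule: less_induct)
    case less
    show ?case
    proof (cases "Suc j = n")
      case True
      then have "\<tau> t * top_ratio (Suc j) t \<le> 1 * top_ratio j t" if "t \<ge> 1" for t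
        using top_ratio_top[OF that] by (auto simp: \<tau>_def)
      then show ?thesis using zero_less_one by blast
    next
      case False
      then have j: "j \<in> {1..n}" "Suc j \<in> {1..n}" "Suc j \<in> {1..<n}" "n \<ge> 2" using less.prems by auto
      obtain D' where D': "D' > 0" "\<And>t. t \<ge> 1 \<Longrightarrow> \<tau> t * top_ratio (Suc (Suc j)) t \<le> D' * top_ratio (Suc j) t"
        using less.hyps[OF _ j(3)] j(3) by force
      \<comment> \<open>\<open>1 + C * D'\<close> is what the derivatives need, the quotient covers time 1\<close>
      define D where "D = 1 + C * D' + \<tau> 1 * top_ratio (Suc j) 1 / top_ratio j 1"
      have q: "\<tau> 1 * top_ratio (Suc j) 1 / top_ratio j 1 > 0" using j \<tau>_pos top_ratio_pos by simp
      have D: "D \<ge> 1 + C * D'" using q by (simp add: D_def)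
      have "\<tau> t * top_ratio (Suc j) t \<le> D * top_ratio j t" if "t \<ge> 1" for t
      proof (rule le_by_derivative[OF that])
        have "\<tau> 1 * top_ratio (Suc j) 1 / top_ratio j 1 \<le> D" using C(1) D'(1) by (simp add: D_def)
        then show "\<tau> 1 * top_ratio (Suc j) 1 \<le> D * top_ratio j 1" using top_ratio_pos[of j 1] j by (simp add: field_simps)
        fix s :: real assume s: "1 \<le> s"
        let ?S = "\<Sum>k=1..n - Suc j. c k s * top_ratio (Suc j + k) s"
        show "((\<lambda>t. \<tau> t * top_ratio (Suc j) t) has_real_derivative (c 1 s * top_ratio (Suc j) s + ?S * \<tau> s)) (at s)"
          by (rule DERIV_mult[OF \<tau>_deriv[OF j(4) s] top_ratio_deriv[OF j(2) s]])
        show "((\<lambda>t. D * top_ratio j t) has_real_derivative D * (\<Sum>k=1..n - j. c k s * top_ratio (j + k) s)) (at s)"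
          by (rule DERIV_cmult[OF top_ratio_deriv[OF j(1) s]])
        have p: "c 1 s > 0" "top_ratio (Suc j) s > 0" "\<tau> s > 0" using pos top_ratio_pos \<tau>_pos j s by auto
        have "?S * \<tau> s \<le> C * (c 1 s * top_ratio (Suc (Suc j)) s) * \<tau> s"
          using C(2)[OF j(3) s] p by (intro mult_right_mono) auto
        also have "\<dots> = C * c 1 s * (\<tau> s * top_ratio (Suc (Suc j)) s)" by simp
        also have "\<dots> \<le> C * c 1 s * (D' * top_ratio (Suc j) s)"
          using C(1) p D'(2)[OF s] by (intro mult_left_mono) auto
        finally have "c 1 s * top_ratio (Suc j) s + ?S * \<tau> s \<le> (1 + C * D') * (c 1 s * top_ratio (Suc j) s)"
          by (simp add: algebra_simps)
        also have "\<dots> \<le> D * (c 1 s * top_ratio (Suc j) s)" using D p by (intro mult_right_mono) auto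
        also have "\<dots> \<le> D * (\<Sum>k=1..n - j. c k s * top_ratio (j + k) s)"
        proof (rule mult_left_mono)
          have "C * D' > 0" using C(1) D'(1) by simp
          then show "0 \<le> D" using D by linarith
        qed (rule top_ratio_deriv_lower[OF less.prems s])
        finally show "c 1 s * top_ratio (Suc j) s + ?S * \<tau> s \<le> D * (\<Sum>k=1..n - j. c k s * top_ratio (j + k) s)" .
      qed
      moreover have "C * D' > 0" using C(1) D'(1) by simp
      ultimately show ?thesis using D by (intro exI[of _ D]) auto
    qed
  qed
  then obtain D where D: "\<And>j. j \<in> {1..<n} \<Longrightarrow> D j > 0"
    "\<And>j t. j \<in> {1..<n} \<Longrightarrow> t \<ge> 1 \<Longrightarrow> \<tau> t * top_ratio (Suc j) t \<le> D j * top_ratio j t"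
    by metis
  show thesis
  proof (rule that[of "1 + (\<Sum>j=1..<n. D j)"])
    have "(\<Sum>j=1..<n. D j) \<ge> 0" using D(1) by (intro sum_nonneg less_imp_le) auto
    then show "1 + (\<Sum>j=1..<n. D j) > 0" by simp
    fix j t assume j: "j \<in> {1..<n}" and t: "(t::real) \<ge> 1"
    have "D j \<le> (\<Sum>j=1..<n. D j)" using j D(1) by (intro member_le_sum less_imp_le) auto
    then have "D j * top_ratio j t \<le> (1 + (\<Sum>j=1..<n. D j)) * top_ratio j t"
      using top_ratio_pos[of j t] j t by (intro mult_right_mono) auto
    then show "\<tau> t * top_ratio (Suc j) t \<le> (1 + (\<Sum>j=1..<n. D j)) * top_ratio j t"
      using D(2)[OF j t] by linarith
  qed
qed

text \<open>
  In this form the derivative involves only the quotients \<open>c k / c 1\<close>. The first sum has the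
  term 1 for \<open>k = 1\<close>; everything else is small as soon as these quotients are.
\<close>

lemma inverse_c1_deriv:
  assumes t: "t \<ge> 1"
  shows "((\<lambda>t. 1 / c 1 t) has_real_derivative
    (\<Sum>k=1..n. c k t / c 1 t) - (\<Sum>k=1..n - 1. (c (1 + k) t / c 1 t) * (c k t / c 1 t))) (at t)"
proof -
  have j: "1 \<in> {1..n}" using n1 by simp
  have c1: "c 1 t \<noteq> 0" using pos[OF j t] by simp
  have "((\<lambda>t. 1 / c 1 t) has_real_derivative - (rbk_rhs n (\<lambda>k. c k t) 1) / (c 1 t)\<^sup>2) (at t)"
    using DERIV_inverse'[OF deriv[OF j t] c1] by (simp add: divide_inverse power2_eq_square mult_ac)
  also have "- (rbk_rhs n (\<lambda>k. c k t) 1) / (c 1 t)\<^sup>2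
     = (c 1 t * (\<Sum>k=1..n. c k t)) / (c 1 t)\<^sup>2 - (\<Sum>k=1..n - 1. c (1 + k) t * c k t) / (c 1 t)\<^sup>2"
    by (simp add: rbk_rhs_def diff_divide_distrib)
  also have "(c 1 t * (\<Sum>k=1..n. c k t)) / (c 1 t)\<^sup>2 = (\<Sum>k=1..n. c k t / c 1 t)"
    using c1 by (simp add: power2_eq_square sum_divide_distrib)
  also have "(\<Sum>k=1..n - 1. c (1 + k) t * c k t) / (c 1 t)\<^sup>2
     = (\<Sum>k=1..n - 1. (c (1 + k) t / c 1 t) * (c k t / c 1 t))"
    by (simp add: power2_eq_square sum_divide_distrib)
  finally show ?thesis .
qed

text \<open>
  The quotients \<open>c k / c 1\<close> are bounded, so \<open>1 / c 1\<close> grows at most linearly and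
  its companion \<open>\<tau>\<close>, whose derivative is \<open>c 1\<close>, at least logarithmically.
\<close>

lemma \<tau>_at_top:
  assumes n2: "n \<ge> 2"
  shows "filterlim \<tau> at_top at_top"
proof -
  obtain K where K: "K \<ge> 1"
    "\<And>j k t. 1 \<le> j \<Longrightarrow> j + k \<le> n \<Longrightarrow> t \<ge> 1 \<Longrightarrow> c (j + k) t \<le> K * c j t"
    using ratio_bounded by metis
  \<comment> \<open>the derivative of \<open>1 / c 1\<close> is at most \<open>n * K\<close>; the last summand covers the value at time 1\<close>
  define B where "B = n * K + 1 / c 1 1"
  have p1: "c 1 t > 0" if "t \<ge> 1" for t using pos[of 1 t] that n1 by auto
  have B: "B > 0" unfolding B_def using K(1) p1[of 1] n1 by (intro add_pos_pos) auto
  have inv: "1 / c 1 t \<le> B * t" if t: "t \<ge> 1" for t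
  proof (rule le_by_derivative[OF t])
    show "1 / c 1 1 \<le> B * 1" using K(1) by (simp add: B_def)
    fix s :: real assume s: "1 \<le> s"
    show "((\<lambda>t. B * t) has_real_derivative B) (at s)" by (auto intro!: derivative_eq_intros)
    let ?Q = "\<Sum>k=1..n - 1. (c (1 + k) s / c 1 s) * (c k s / c 1 s)"
    show "((\<lambda>t. 1 / c 1 t) has_real_derivative (\<Sum>k=1..n. c k s / c 1 s) - ?Q) (at s)"
      by (rule inverse_c1_deriv[OF s])
    have "?Q \<ge> 0" using pos s p1[OF s]
      by (intro sum_nonneg mult_nonneg_nonneg divide_nonneg_nonneg less_imp_le) auto
    moreover have "(\<Sum>k=1..n. c k s / c 1 s) \<le> (\<Sum>k=1..n. K)"
    proof (rule sum_mono)
      fix k assume "k \<in> {1..n}"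
      then have "c k s \<le> K * c 1 s" using K(2)[of 1 "k - 1" s] s by auto
      then show "c k s / c 1 s \<le> K" using p1[OF s] by (simp add: field_simps)
    qed
    moreover have "(\<Sum>k=1..n. K) \<le> B" unfolding B_def using p1[of 1] by simp
    ultimately show "(\<Sum>k=1..n. c k s / c 1 s) - ?Q \<le> B" by linarith
  qed
  have lb: "ln t / B \<le> \<tau> t" if t: "t \<ge> 1" for t
  proof (rule le_by_derivative[OF t])
    show "ln 1 / B \<le> \<tau> 1" using \<tau>_pos[OF n2, of 1] by simp
    fix s :: real assume s: "1 \<le> s"
    show "((\<lambda>t. ln t / B) has_real_derivative (1 / s) / B) (at s)"
      using s B by (auto intro!: derivative_eq_intros)
    show "(\<tau> has_real_derivative c 1 s) (at s)" by (rule \<tau>_deriv[OF n2 s])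
    show "1 / s / B \<le> c 1 s" using inv[OF s] p1[OF s] s B by (simp add: field_simps)
  qed
  have "filterlim (\<lambda>t. ln t / B) at_top at_top"
    using B using filterlim_tendsto_pos_mult_at_top[OF tendsto_const[of "1 / B"] _ ln_at_top] by simp
  then show ?thesis
    by (rule filterlim_at_top_mono) (use lb in \<open>auto intro: eventually_mono[OF eventually_ge_at_top[of 1]]\<close>)
qed

text \<open>
  One step down from index 2 to index 1 already gains a factor \<open>\<tau>\<close>, and
  \<open>\<tau>\<close> diverges.
\<close>

lemma ratio_tendsto_0:
  assumes k: "k \<in> {2..n}"
  shows "((\<lambda>t. c k t / c 1 t) \<longlongrightarrow> 0) at_top"
proof -
  have n2: "n \<ge> 2" using k by simp
  obtain D where D: "D > 0" "\<And>j t. j \<in> {1..<n} \<Longrightarrow> t \<ge> 1 \<Longrightarrow> \<tau> t * top_ratio (Suc j) t \<le> D * top_ratio j t"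
    using \<tau>_gap by blast
  obtain K where K: "K \<ge> 1"
    "\<And>j k t. 1 \<le> j \<Longrightarrow> j + k \<le> n \<Longrightarrow> t \<ge> 1 \<Longrightarrow> top_ratio (j + k) t \<le> K * top_ratio j t"
    using ratio_bounded by metis
  have "((\<lambda>t. K * D / \<tau> t) \<longlongrightarrow> 0) at_top"
    by (intro tendsto_divide_0[OF tendsto_const] filterlim_at_top_imp_at_infinity \<tau>_at_top n2)
  moreover have "\<forall>\<^sub>F t in at_top. norm (c k t / c 1 t) \<le> K * D / \<tau> t"
    using eventually_ge_at_top[of 1]
  proof eventually_elim
    case (elim t)
    have p: "\<tau> t > 0" "top_ratio 1 t > 0" "top_ratio k t > 0" using \<tau>_pos top_ratio_pos n2 k elim by auto
    have "top_ratio k t \<le> K * top_ratio 2 t" using K(2)[of 2 "k - 2" t] k elim by (simp del: add_2_eq_Suc)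
    then have "\<tau> t * top_ratio k t \<le> K * (\<tau> t * top_ratio (Suc 1) t)"
      using p(1) by (simp add: mult.left_commute numeral_2_eq_2)
    also have "\<dots> \<le> K * (D * top_ratio 1 t)" using D(2)[of 1 t] K(1) n2 elim by (intro mult_left_mono) auto
    finally have "top_ratio k t / top_ratio 1 t \<le> K * D / \<tau> t" using p by (simp add: field_simps)
    then show ?case using p top_ratio_quotient[OF elim, of k 1] by (metis abs_of_nonneg divide_nonneg_nonneg less_imp_le real_norm_def)
  qed
  ultimately show ?thesis by (rule Lim_null_comparison[rotated])
qed

text \<open>
  In the derivative of \<open>1 / c 1\<close> all quotients except \<open>c 1 / c 1\<close> tend to 0, so
  l'Hospital's rule applies to \<open>(1 / c 1 t) / t\<close>.
\<close>

lemma c1_asymptotics: "((\<lambda>t. t * c 1 t) \<longlongrightarrow> 1) at_top"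
proof -
  have p1: "c 1 t > 0" if "t \<ge> 1" for t using pos[of 1 t] that n1 by auto
  have one: "((\<lambda>t. c 1 t / c 1 t) \<longlongrightarrow> 1) at_top"
    by (rule tendsto_eventually, rule eventually_mono[OF eventually_ge_at_top[of 1]]) (use p1 in force)
  have lim: "((\<lambda>t. c k t / c 1 t) \<longlongrightarrow> (if k = 1 then 1 else 0)) at_top" if "k \<in> {1..n}" for k
    using one ratio_tendsto_0[of k] that by (cases "k = 1") auto
  have "((\<lambda>t. (\<Sum>k=1..n. c k t / c 1 t) - (\<Sum>k=1..n - 1. (c (1 + k) t / c 1 t) * (c k t / c 1 t)))
     \<longlongrightarrow> (\<Sum>k=1..n. if k = 1 then 1 else 0) - (\<Sum>k=1..n - 1. 0 * (if k = 1 then 1 else 0))) at_top"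
    by (intro tendsto_diff tendsto_sum tendsto_mult lim ratio_tendsto_0) auto
  moreover have "(\<Sum>k=1..n. if k = 1 then 1 else (0::real)) = 1" using n1 by (subst sum.delta) auto
  ultimately have "((\<lambda>t. ((\<Sum>k=1..n. c k t / c 1 t) -
      (\<Sum>k=1..n - 1. (c (1 + k) t / c 1 t) * (c k t / c 1 t))) / 1) \<longlongrightarrow> 1) at_top"
    by simp
  then have "((\<lambda>t. (1 / c 1 t) / t) \<longlongrightarrow> 1) at_top"
  proof (rule lhospital_at_top_at_top[rotated -1])
    show "\<forall>\<^sub>F t in at_top. ((\<lambda>t. 1 / c 1 t) has_real_derivative (\<Sum>k=1..n. c k t / c 1 t) -
      (\<Sum>k=1..n - 1. (c (1 + k) t / c 1 t) * (c k t / c 1 t))) (at t)"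
      by (rule eventually_mono[OF eventually_ge_at_top[of 1]], rule inverse_c1_deriv)
  qed (auto simp: filterlim_ident)
  then have "((\<lambda>t. inverse ((1 / c 1 t) / t)) \<longlongrightarrow> inverse 1) at_top"
    by (rule tendsto_inverse) simp
  then show ?thesis by (simp add: mult.commute divide_inverse)
qed

lemma \<tau>_asymptotics:
  assumes "n \<ge> 2"
  shows "((\<lambda>t. \<tau> t / ln t) \<longlongrightarrow> 1) at_top"
proof (rule lhospital_at_top_at_top[OF ln_at_top])
  show "\<forall>\<^sub>F t in at_top. (\<tau> has_real_derivative c 1 t) (at t)"
    by (rule eventually_mono[OF eventually_ge_at_top[of 1]], rule \<tau>_deriv[OF assms])
  show "\<forall>\<^sub>F t::real in at_top. (ln has_real_derivative 1 / t) (at t)"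
    by (rule eventually_mono[OF eventually_gt_at_top[of 0]]) (auto intro!: derivative_eq_intros)
  show "\<forall>\<^sub>F t::real in at_top. 1 / t \<noteq> 0"
    by (rule eventually_mono[OF eventually_gt_at_top[of 0]]) auto
  show "((\<lambda>t. c 1 t / (1 / t)) \<longlongrightarrow> 1) at_top"
    using c1_asymptotics by (simp add: mult.commute)
qed

text \<open>
  L'Hospital's rule against \<open>\<tau> ^ i\<close>: after division by \<open>c 1\<close>, all terms of the
  derivative but the one for \<open>k = 1\<close> are negligible, and that one is governed by the
  induction hypothesis.
\<close>

lemma top_ratio_asymptotics:
  assumes "n \<ge> 2" "i < n"
  shows "((\<lambda>t. top_ratio (n - i) t / \<tau> t ^ i) \<longlongrightarrow> 1 / fact i) at_top"
  using assms(2)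
proof (induction i)
  case 0
  show ?case
    by (rule tendsto_eventually, rule eventually_mono[OF eventually_ge_at_top[of 1]]) (simp add: top_ratio_top)
next
  case (Suc i)
  define j where "j = n - Suc i"
  have j: "j \<in> {1..n}" "j \<in> {1..<n}" "Suc j = n - i" "n - j = Suc i" using Suc.prems by (auto simp: j_def)
  obtain K where K: "K \<ge> 1"
    "\<And>j k t. 1 \<le> j \<Longrightarrow> j + k \<le> n \<Longrightarrow> t \<ge> 1 \<Longrightarrow> top_ratio (j + k) t \<le> K * top_ratio j t"
    using ratio_bounded by metis
  have summand: "((\<lambda>t. (c k t / c 1 t) * (top_ratio (j + k) t / \<tau> t ^ i)) \<longlongrightarrow> (if k = 1 then 1 / fact i else 0)) at_top"
    if k: "k \<in> {1..n - j}" for k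
  proof (cases "k = 1")
    case True
    have "((\<lambda>t. top_ratio (n - i) t / \<tau> t ^ i) \<longlongrightarrow> 1 / fact i) at_top" using Suc by simp
    then have "((\<lambda>t. (c k t / c 1 t) * (top_ratio (j + k) t / \<tau> t ^ i)) \<longlongrightarrow> 1 / fact i) at_top"
    proof (rule Lim_transform_eventually)
      show "\<forall>\<^sub>F t in at_top. top_ratio (n - i) t / \<tau> t ^ i = (c k t / c 1 t) * (top_ratio (j + k) t / \<tau> t ^ i)"
        using eventually_ge_at_top[of 1]
      proof eventually_elim
        case (elim t)
        then have "c 1 t > 0" using pos[of 1 t] n1 by auto
        then show ?case using True j(3) by simp
      qed
    qed
    then show ?thesis using True by simp
  next
    case False
    have k2: "k \<in> {2..n}" using k False by auto
    have "((\<lambda>t. (c k t / c 1 t) * (K * (top_ratio (n - i) t / \<tau> t ^ i))) \<longlongrightarrow> 0 * (K * (1 / fact i))) at_top"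
      using Suc by (intro tendsto_mult tendsto_const ratio_tendsto_0[OF k2]) auto
    then have l: "((\<lambda>t. (c k t / c 1 t) * (K * (top_ratio (n - i) t / \<tau> t ^ i))) \<longlongrightarrow> 0) at_top" by simp
    have "((\<lambda>t. (c k t / c 1 t) * (top_ratio (j + k) t / \<tau> t ^ i)) \<longlongrightarrow> 0) at_top"
    proof (rule tendsto_0_le[OF l, where K = 1])
      show "\<forall>\<^sub>F t in at_top. norm ((c k t / c 1 t) * (top_ratio (j + k) t / \<tau> t ^ i))
          \<le> norm ((c k t / c 1 t) * (K * (top_ratio (n - i) t / \<tau> t ^ i))) * 1"
        using eventually_ge_at_top[of 1]
      proof eventually_elim
        case (elim t)
        have p: "c k t > 0" "c 1 t > 0" "\<tau> t > 0" "top_ratio (j + k) t > 0" "top_ratio (n - i) t > 0"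
          using pos[of k t] pos[of 1 t] \<tau>_pos[OF assms(1)] top_ratio_pos[of "j + k" t] top_ratio_pos[of "n - i" t] elim k j n1 k2 Suc.prems by auto
        have idx: "Suc j + (k - 1) = j + k" using k by auto
        have "top_ratio (j + k) t \<le> K * top_ratio (n - i) t"
          using K(2)[of "Suc j" "k - 1" t, unfolded idx] k j elim by auto
        then have "top_ratio (j + k) t / \<tau> t ^ i \<le> K * top_ratio (n - i) t / \<tau> t ^ i"
          using p by (intro divide_right_mono) auto
        then have "(c k t / c 1 t) * (top_ratio (j + k) t / \<tau> t ^ i) \<le> (c k t / c 1 t) * (K * (top_ratio (n - i) t / \<tau> t ^ i))"
          using p by (intro mult_left_mono) auto
        moreover have "0 \<le> (c k t / c 1 t) * (top_ratio (j + k) t / \<tau> t ^ i)"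
          using p by simp
        ultimately show ?case unfolding real_norm_def mult_1_right by linarith
      qed
    qed
    then show ?thesis using False by simp
  qed
  have "((\<lambda>t. (\<Sum>k=1..n - j. (c k t / c 1 t) * (top_ratio (j + k) t / \<tau> t ^ i)) / (Suc i)) \<longlongrightarrow>
      (\<Sum>k=1..n - j. if k = 1 then 1 / fact i else 0) / (Suc i)) at_top"
    by (intro tendsto_divide tendsto_const tendsto_sum summand) auto
  also have "(\<Sum>k=1..n - j. if k = 1 then 1 / fact i else (0::real)) / (Suc i) = 1 / fact (Suc i)"
    by (subst sum.delta) (auto simp: j(4) field_simps)
  finally have "((\<lambda>t. (\<Sum>k=1..n - j. c k t * top_ratio (j + k) t) / (Suc i * \<tau> t ^ i * c 1 t))
      \<longlongrightarrow> 1 / fact (Suc i)) at_top"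
    by (simp add: sum_divide_distrib mult_ac)
  then have "((\<lambda>t. top_ratio j t / \<tau> t ^ Suc i) \<longlongrightarrow> 1 / fact (Suc i)) at_top"
  proof (rule lhospital_at_top_at_top[rotated -1])
    show "LIM t at_top. \<tau> t ^ Suc i :> at_top"
      by (intro filterlim_pow_at_top \<tau>_at_top assms) auto
    show "\<forall>\<^sub>F t in at_top. (top_ratio j has_real_derivative (\<Sum>k=1..n - j. c k t * top_ratio (j + k) t)) (at t)"
      by (rule eventually_mono[OF eventually_ge_at_top[of 1]], rule top_ratio_deriv[OF j(1)])
    show "\<forall>\<^sub>F t in at_top. ((\<lambda>t. \<tau> t ^ Suc i) has_real_derivative Suc i * \<tau> t ^ i * c 1 t) (at t)"
      using eventually_ge_at_top[of 1]
    proof eventually_elim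
      case (elim t)
      from DERIV_power_Suc[OF \<tau>_deriv[OF assms(1) elim], of i] show ?case
        by (simp add: mult_ac)
    qed
    show "\<forall>\<^sub>F t in at_top. Suc i * \<tau> t ^ i * c 1 t \<noteq> 0"
      using eventually_ge_at_top[of 1]
    proof eventually_elim
      case (elim t)
      then show ?case using \<tau>_pos[OF assms(1)] pos[of 1 t] n1 by force
    qed
  qed
  then show ?case by (simp add: j_def)
qed

text \<open>
  Combine the growth of the quotients with \<open>c 1 \<sim> 1 / t\<close> and \<open>\<tau> \<sim> ln t\<close> in
  \<open>c j = (top_ratio j / top_ratio 1) * c 1\<close>.
\<close>

lemma component_asymptotics:
  assumes j: "j \<in> {1..n}"
  shows "((\<lambda>t. c j t * (t * ln t ^ (j - 1))) \<longlongrightarrow> amplitude n j) at_top"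
proof (cases "j = 1")
  case True
  then show ?thesis using c1_asymptotics by (simp add: amplitude_def mult.commute)
next
  case False
  then have n2: "n \<ge> 2" using j by auto
  have "((\<lambda>t. (top_ratio (n - (n - j)) t / \<tau> t ^ (n - j)) / (top_ratio (n - (n - 1)) t / \<tau> t ^ (n - 1))
      * (t * c 1 t) * inverse ((\<tau> t / ln t) ^ (j - 1)))
    \<longlongrightarrow> (1 / fact (n - j)) / (1 / fact (n - 1)) * 1 * inverse (1 ^ (j - 1))) at_top"
    using j n2 by (intro tendsto_mult tendsto_divide tendsto_inverse tendsto_power
        top_ratio_asymptotics c1_asymptotics \<tau>_asymptotics) auto
  also have "(1 / fact (n - j)) / (1 / fact (n - 1)) * 1 * inverse (1 ^ (j - 1)) = amplitude n j"
    by (simp add: amplitude_def)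
  finally show ?thesis
  proof (rule Lim_transform_eventually)
    show "\<forall>\<^sub>F t in at_top. (top_ratio (n - (n - j)) t / \<tau> t ^ (n - j)) / (top_ratio (n - (n - 1)) t / \<tau> t ^ (n - 1))
      * (t * c 1 t) * inverse ((\<tau> t / ln t) ^ (j - 1)) = c j t * (t * ln t ^ (j - 1))"
      using eventually_gt_at_top[of 1]
    proof eventually_elim
      case (elim t)
      have p: "c 1 t > 0" "\<tau> t > 0" "ln t > 0" "c n t > 0"
        using pos[of 1 t] pos[of n t] \<tau>_pos[OF n2] elim n1 by auto
      have e: "n - (n - j) = j" "n - (n - 1) = 1" "\<tau> t ^ (n - 1) = \<tau> t ^ (n - j) * \<tau> t ^ (j - 1)"
        using j by (auto simp flip: power_add)
      show ?case unfolding e top_ratio_def using p by (simp add: field_simps power_divide)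
    qed
  qed
qed

end

section \<open>Reduction to coprime support\<close>

text \<open>
  A product \<open>x (i * m + k) * x k\<close> survives only if \<open>m\<close> divides \<open>k\<close>, so
  both sums reduce to sums over multiples of \<open>m\<close>.
\<close>

lemma rbk_rhs_multiples:
  assumes m: "m > 0" and i: "i \<in> {1..n}" and n: "n * m \<le> N"
    and off: "\<And>k. k \<in> {1..N} \<Longrightarrow> \<not> (m dvd k \<and> k \<le> n * m) \<Longrightarrow> x k = 0"
  shows "rbk_rhs N x (i * m) = rbk_rhs n (\<lambda>k. x (k * m)) i"
proof -
  have inj: "inj_on (\<lambda>k. k * m) A" for A using m by (auto simp: inj_on_def)
  have "(\<Sum>k=1..N. x k) = sum x ((\<lambda>k. k * m) ` {1..n})"
  proof (rule sum.mono_neutral_right)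
    show "(\<lambda>k. k * m) ` {1..n} \<subseteq> {1..N}"
    proof (rule image_subsetI)
      fix k assume "k \<in> {1..n}"
      then have "1 \<le> k" "k \<le> n" by auto
      then have "1 * 1 \<le> k * m" "k * m \<le> N"
        using m by (intro mult_le_mono order_trans[OF _ n]; simp)+
      then show "k * m \<in> {1..N}" by simp
    qed
    show "\<forall>k\<in>{1..N} - (\<lambda>k. k * m) ` {1..n}. x k = 0"
    proof
      fix k assume k: "k \<in> {1..N} - (\<lambda>k. k * m) ` {1..n}"
      have "\<not> (m dvd k \<and> k \<le> n * m)"
      proof
        assume "m dvd k \<and> k \<le> n * m"
        then obtain q where q: "k = m * q" "k \<le> n * m" unfolding dvd_def by blast
        then have "q \<le> n" "q \<ge> 1" using m k by (auto simp: mult.commute Suc_le_eq)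
        then show False using k q(1) by (auto simp: mult.commute)
      qed
      then show "x k = 0" using k off by auto
    qed
  qed auto
  then have 1: "(\<Sum>k=1..N. x k) = (\<Sum>k=1..n. x (k * m))"
    by (simp add: sum.reindex[OF inj] o_def)
  have "(\<Sum>k=1..N - i * m. x (i * m + k) * x k)
      = (\<Sum>k\<in>(\<lambda>k. k * m) ` {1..n - i}. x (i * m + k) * x k)"
  proof (rule sum.mono_neutral_right)
    show "(\<lambda>k. k * m) ` {1..n - i} \<subseteq> {1..N - i * m}"
    proof (rule image_subsetI)
      fix k assume "k \<in> {1..n - i}"
      then have "1 \<le> k" "i + k \<le> n" using i by auto
      then have "1 * 1 \<le> k * m" "(i + k) * m \<le> N"
        using m by (intro mult_le_mono order_trans[OF _ n]; simp)+
      then show "k * m \<in> {1..N - i * m}" by (simp add: add_mult_distrib)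
    qed
    show "\<forall>k\<in>{1..N - i * m} - (\<lambda>k. k * m) ` {1..n - i}. x (i * m + k) * x k = 0"
    proof
      fix k assume k: "k \<in> {1..N - i * m} - (\<lambda>k. k * m) ` {1..n - i}"
      show "x (i * m + k) * x k = 0"
      proof (cases "m dvd k")
        case True
        then obtain q where q: "k = m * q" unfolding dvd_def by blast
        have "q \<ge> 1" using k q by (cases q) auto
        moreover have "q \<notin> {1..n - i}" using k q by (auto simp: mult.commute)
        ultimately have "n < i + q" using i by auto
        then have "n * m < (i + q) * m" using m by simp
        also have "\<dots> = i * m + k" by (simp add: q algebra_simps)
        finally have "n * m < i * m + k" .
        then have "x (i * m + k) = 0" using k by (intro off) auto
        then show ?thesis by simp
      next
        case False
        then have "x k = 0" using k by (intro off) auto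
        then show ?thesis by simp
      qed
    qed
  qed auto
  then have 2: "(\<Sum>k=1..N - i * m. x (i * m + k) * x k) = (\<Sum>k=1..n - i. x ((i + k) * m) * x (k * m))"
    by (simp add: sum.reindex[OF inj] o_def algebra_simps)
  show ?thesis unfolding rbk_rhs_def 1 2 ..
qed

lemma Gcd_scaled:
  fixes P :: "nat set"
  assumes "m = Gcd P" "m > 0"
  shows "Gcd {i. i * m \<in> P} = 1"
proof -
  have "m * Gcd {i. i * m \<in> P} dvd a" if a: "a \<in> P" for a
  proof -
    obtain i where "a = m * i" using Gcd_dvd[OF a] assms(1) unfolding dvd_def by blast
    moreover from this have "Gcd {i. i * m \<in> P} dvd i" using a by (intro Gcd_dvd) (simp add: mult.commute)
    ultimately show ?thesis by simp
  qed
  then have "m * Gcd {i. i * m \<in> P} dvd m * 1" using assms(1) by (auto intro: Gcd_greatest)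
  then show ?thesis using assms(2) by simp
qed

theorem theorem2p1:
  fixes N :: nat and c :: "nat \<Rightarrow> real \<Rightarrow> real" and P :: "nat set" and m p :: nat
  assumes "N \<ge> 3"
    and "rbk_solution N c"
    and "\<forall>j\<in>{1..N}. c j 0 \<ge> 0"
    and "P = {j \<in> {1..N}. c j 0 > 0}"
    and "m = Gcd P"
    and "p = Sup P"
  shows "(\<forall>j\<in>{1..N}. m dvd j \<and> j \<le> p \<longrightarrow>
            (\<exists>e :: real \<Rightarrow> real. (e \<longlongrightarrow> 0) at_top \<and>
               (\<forall>t\<ge>0. t * ln t ^ (j div m - 1) \<noteq> 0 \<longrightarrow>
                  c j t = amplitude (p div m) (j div m) / (t * ln t ^ (j div m - 1)) * (1 + e t))))
       \<and> (\<forall>j\<in>{1..N}. \<not> (m dvd j \<and> j \<le> p) \<longrightarrow> (\<forall>t\<ge>0. c j t = 0))"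
proof -
  note sol = \<open>rbk_solution N c\<close>
  have init: "\<And>j. j \<in> {1..N} \<Longrightarrow> c j 0 \<ge> 0" using assms(3) by blast
  have finP: "finite P" using assms(4) by simp
  have P_le: "a \<le> p" if "a \<in> P" for a
    using that finP assms(6) by (simp add: le_cSup_finite)
  have P_dvd: "m dvd a" if "a \<in> P" for a using that assms(5) by simp
  \<comment> \<open>the indices that never appear: no reaction between the other ones produces them\<close>
  define B where "B = {j \<in> {1..N}. \<not> (m dvd j \<and> j \<le> p)}"
  have B_init: "c a 0 = 0" if "a \<in> B" for a
  proof -
    have a: "a \<in> {1..N}" "a \<notin> P" using that P_le P_dvd unfolding B_def by blast+
    then have "\<not> c a 0 > 0" using assms(4) by simp
    then show ?thesis using init[OF a(1)] by simp
  qed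
  have B_closed: "a + k \<in> B \<or> k \<in> B" if "a \<in> B" "k \<in> {1..N - a}" for a k
  proof -
    have "\<not> (m dvd a + k \<and> a + k \<le> p) \<or> \<not> (m dvd k \<and> k \<le> p)"
    proof (cases "m dvd a")
      case True
      then have "a > p" using that(1) by (simp add: B_def)
      then show ?thesis by linarith
    next
      case False
      then show ?thesis using dvd_add_left_iff[of m k a] by blast
    qed
    moreover have "a + k \<in> {1..N}" "k \<in> {1..N}" using that by (auto simp: B_def)
    ultimately show ?thesis by (simp add: B_def)
  qed
  have zero: "c j t = 0" if j: "j \<in> {1..N}" "\<not> (m dvd j \<and> j \<le> p)" and t: "t \<ge> 0" for j t
  proof (rule rbk_solution_zero[OF sol init _ B_init B_closed _ t])
    show "B \<subseteq> {1..N}" "j \<in> B" using j by (auto simp: B_def)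
  qed
  have "\<exists>e :: real \<Rightarrow> real. (e \<longlongrightarrow> 0) at_top \<and>
               (\<forall>t\<ge>0. t * ln t ^ (j div m - 1) \<noteq> 0 \<longrightarrow>
                  c j t = amplitude (p div m) (j div m) / (t * ln t ^ (j div m - 1)) * (1 + e t))"
    if j: "j \<in> {1..N}" "m dvd j" "j \<le> p" for j
  proof -
    have "p > 0" using j by auto
    then have "P \<noteq> {}" using assms(6) by (intro notI) (simp add: Sup_nat_def)
    then have pP: "p \<in> P" using finP assms(6) by (simp add: cSup_eq_Max)
    have p: "p \<in> {1..N}" "c p 0 > 0" "m dvd p" using pP assms(4) P_dvd by auto
    have m: "m > 0" using p by (cases m) auto
    define n where "n = p div m"
    define i where "i = j div m"
    define d where "d i = c (i * m)" for i
    have pn: "n * m = p" using p(3) by (simp add: n_def)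
    have ji: "i * m = j" using j(2) by (simp add: i_def)
    have n1: "n \<ge> 1" using pn \<open>p > 0\<close> by (cases n) auto
    have i: "i \<in> {1..n}"
    proof -
      have "i \<ge> 1" using ji j(1) by (cases i) auto
      moreover have "i \<le> n" using j(3) m unfolding ji[symmetric] pn[symmetric] by simp
      ultimately show ?thesis by simp
    qed
    have range: "k * m \<in> {1..N}" if "k \<in> {1..n}" for k
    proof -
      have "k * m \<le> n * m" using that by (intro mult_le_mono1) auto
      then have "k * m \<le> N" using pn p(1) by auto
      moreover have "1 * 1 \<le> k * m" using that m by (intro mult_le_mono) auto
      ultimately show ?thesis by simp
    qed
    have dsol: "rbk_solution n d"
      unfolding rbk_solution_def
    proof (intro ballI allI impI)
      fix k t assume k: "k \<in> {1..n}" and t: "(t::real) \<ge> 0"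
      have "rbk_rhs N (\<lambda>k. c k t) (k * m) = rbk_rhs n (\<lambda>k. c (k * m) t) k"
        by (rule rbk_rhs_multiples[OF m k]) (use pn p(1) zero t in auto)
      then show "(d k has_real_derivative rbk_rhs n (\<lambda>k. d k t) k) (at t within {0..})"
        using sol range[OF k] t unfolding d_def rbk_solution_def by metis
    qed
    have "{k \<in> {1..n}. d k 0 > 0} = {k. k * m \<in> P}"
    proof (intro equalityI subsetI)
      fix k assume "k \<in> {k. k * m \<in> P}"
      then have k: "k * m \<in> P" by simp
      then have "k * m \<le> n * m" "k * m \<ge> 1" using P_le pn assms(4) by auto
      then have "k \<le> n" "k \<ge> 1" using m by (simp, cases k) auto
      then have "k \<in> {1..n}" by simp
      then show "k \<in> {k \<in> {1..n}. d k 0 > 0}" using k assms(4) by (simp add: d_def)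
    next
      fix k assume "k \<in> {k \<in> {1..n}. d k 0 > 0}"
      then have "k * m \<in> {1..N}" "c (k * m) 0 > 0" using range[of k] by (simp_all add: d_def)
      then show "k \<in> {k. k * m \<in> P}" using assms(4) by simp
    qed
    then have "Gcd {k \<in> {1..n}. d k 0 > 0} = 1" using Gcd_scaled[OF assms(5) m] by simp
    moreover have "d k 0 \<ge> 0" if "k \<in> {1..n}" for k
      unfolding d_def by (rule init[OF range[OF that]])
    moreover have "d n 0 > 0" using p(2) by (simp add: d_def pn)
    ultimately have dpos: "d k t > 0" if "k \<in> {1..n}" "t > 0" for k t
      using rbk_solution_all_pos[OF dsol _ n1 _ _ that] by blast
    interpret positive_rbk n d
    proof
      show "n \<ge> 1" by (rule n1)
      fix k t assume "k \<in> {1..n}" "(t::real) \<ge> 1"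
      then show "d k t > 0" "(d k has_real_derivative rbk_rhs n (\<lambda>k. d k t) k) (at t)"
        using dpos[of k t] rbk_solution_deriv[OF dsol, of k t] by simp_all
    qed
    define A where "A = amplitude n i"
    have A: "A \<noteq> 0" by (simp add: A_def amplitude_def)
    define e where "e t = c j t * (t * ln t ^ (i - 1)) / A - 1" for t
    have "((\<lambda>t. d i t * (t * ln t ^ (i - 1)) / A - 1) \<longlongrightarrow> A / A - 1) at_top"
      unfolding A_def using A A_def by (intro tendsto_intros component_asymptotics i) auto
    then have "(e \<longlongrightarrow> 0) at_top" using A by (simp add: e_def[abs_def] d_def ji)
    moreover have "c j t = A / (t * ln t ^ (i - 1)) * (1 + e t)" if "t * ln t ^ (i - 1) \<noteq> 0" for t
    proof -
      have "y = A / w * (1 + (y * w / A - 1))" if "w \<noteq> 0" for y w :: real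
        using that A by simp
      from this[OF that] show ?thesis unfolding e_def .
    qed
    ultimately show ?thesis unfolding A_def i_def n_def by blast
  qed
  then show ?thesis using zero by blast
qed

end
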